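(* Let $\mu>0$, $s>0$. Let $\varphi:\mathbb{R}\to\mathbb{R}$ be strictly convex on $\mathbb{R}$, differentiable on $\mathbb{R}\setminus\{\mu\}$, with $\lim_{|x|\to\infty}|\varphi(x)/x|=\infty$, and normalized so that $\varphi(\mu)=0$ and $\varphi$ attains its global minimum at $\mu$. Let $\psi_u,\psi_\ell:\mathbb{R}\to\mathbb{R}$ be functions for which there exists $t\in\mathbb{R}$ such that (i) $\psi_u$ is concave and non-decreasing on $\{x:x<t\}$ and on $\{x:x\ge t\}$; (ii) $\psi_\ell$ is convex and non-increasing on $\{x:x<t\}$ and on $\{x:x\ge t\}$. Assume moreover that for every fixed $v_1<\mu$ the function $$g(v_1,v_2)=\frac{w_1(v_2)\psi_u(v_1)+w_2(v_2)\psi_u(v_2)}{w_1(v_2)\psi_\ell(v_1)+w_2(v_2)\psi_\ell(v_2)},\qquad w_2(v_2)=\frac{\mu-v_1}{v_2-v_1},\quad w_1(v_2)=1-w_2(v_2),$$ is non-decreasing in $v_2\in(\mu,\infty)$. Then the problem $$\sup_{\mathbb{P}\in\mathcal{P}(\mu,s,\varphi)}\frac{\mathbb{E}_{\mathbb{P}}(\psi_u(X))}{\mathbb{E}_{\mathbb{P}}(\psi_\ell(X))}$$ reduces to (i.e. has the same optimal value as) the problem over two-point distributions $$\sup\left\{\frac{w_1\psi_u(v_1)+w_2\psi_u(v_2)}{w_1\psi_\ell(v_1)+w_2\psi_\ell(v_2)}\;:\; w_1,w_2\ge 0,\ v_1<\mu<v_2,\ w_1+w_2=1,\ w_1v_1+w_2v_2=\mu,\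 w_1\varphi(v_1)+w_2\varphi(v_2)=s\right\}.$$
   Context: $\mathcal{P}(\mu,s,\varphi)$ is the set of all probability distributions $\mathbb{P}$ on $\mathbb{R}$ such that, for $X\sim\mathbb{P}$, $\mathbb{E}_{\mathbb{P}}(X)=\mu$ and $\mathbb{E}_{\mathbb{P}}(\varphi(X))=s$. The ratios appearing are understood to be well defined (finite expectations, nonzero denominators).
   Formalization: Adds the assumption that some feasible distribution (with finite expectations) has E(ψ_u(X)) ≥ 0 and E(ψ_ℓ(X)) > 0; without such a sign condition the claim fails, e.g. for ψ_u = −1 and a suitable positive convex non-increasing ψ_ℓ. *)

theory Defs
  imports "HOL-Probability.Probability"
begin

definition strictly_convex :: "(real \<Rightarrow> real) \<Rightarrow> bool" where
  "strictly_convex f \<longleftrightarrow>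
     (\<forall>x y u. x \<noteq> y \<longrightarrow> 0 < u \<longrightarrow> u < 1 \<longrightarrow>
        f ((1 - u) * x + u * y) < (1 - u) * f x + u * f y)"

text \<open>The Bochner integral of a non-integrable function is 0, so the moment conditions
  below carry integrability explicitly.\<close>

definition moment_class :: "real \<Rightarrow> real \<Rightarrow> (real \<Rightarrow> real) \<Rightarrow> real measure set" where
  "moment_class \<mu> s \<phi> =
     {P. prob_space P \<and> sets P = sets borel \<and>
         integrable P (\<lambda>x. x) \<and> integral\<^sup>L P (\<lambda>x. x) = \<mu> \<and>
         integrable P \<phi> \<and> integral\<^sup>L P \<phi> = s}"

text \<open>The members of the moment class for which both expectations in the objective
  \<open>E(\<psi>u X) / E(\<psi>l X)\<close> are finite. If they are finite on all of
  the moment class, this is the moment class itself.\<close>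

definition ratio_class ::
  "real \<Rightarrow> real \<Rightarrow> (real \<Rightarrow> real) \<Rightarrow> (real \<Rightarrow> real) \<Rightarrow> (real \<Rightarrow> real) \<Rightarrow> real measure set" where
  "ratio_class \<mu> s \<phi> \<psi>u \<psi>l =
     {P \<in> moment_class \<mu> s \<phi>. integrable P \<psi>u \<and> integrable P \<psi>l}"

definition weight2 :: "real \<Rightarrow> real \<Rightarrow> real \<Rightarrow> real" where
  "weight2 \<mu> v1 v2 = (\<mu> - v1) / (v2 - v1)"

definition weight1 :: "real \<Rightarrow> real \<Rightarrow> real \<Rightarrow> real" where
  "weight1 \<mu> v1 v2 = 1 - weight2 \<mu> v1 v2"

definition two_point_mean :: "real \<Rightarrow> (real \<Rightarrow> real) \<Rightarrow> real \<Rightarrow> real \<Rightarrow> real" where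
  "two_point_mean \<mu> f v1 v2 = weight1 \<mu> v1 v2 * f v1 + weight2 \<mu> v1 v2 * f v2"

definition g_ratio ::
  "real \<Rightarrow> (real \<Rightarrow> real) \<Rightarrow> (real \<Rightarrow> real) \<Rightarrow> real \<Rightarrow> real \<Rightarrow> real" where
  "g_ratio \<mu> \<psi>u \<psi>l v1 v2 = two_point_mean \<mu> \<psi>u v1 v2 / two_point_mean \<mu> \<psi>l v1 v2"

definition two_point_ratios ::
  "real \<Rightarrow> real \<Rightarrow> (real \<Rightarrow> real) \<Rightarrow> (real \<Rightarrow> real) \<Rightarrow> (real \<Rightarrow> real) \<Rightarrow> real set" where
  "two_point_ratios \<mu> s \<phi> \<psi>u \<psi>l =
     {(w1 * \<psi>u v1 + w2 * \<psi>u v2) / (w1 * \<psi>l v1 + w2 * \<psi>l v2) | w1 w2 v1 v2.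
        0 \<le> w1 \<and> 0 \<le> w2 \<and> v1 < \<mu> \<and> \<mu> < v2 \<and> w1 + w2 = 1 \<and>
        w1 * v1 + w2 * v2 = \<mu> \<and> w1 * \<phi> v1 + w2 * \<phi> v2 = s}"

text \<open>On the sign normalisation of the ratio. The ratio class is closed under
  mixtures, so a denominator \<open>E(\<psi>l X)\<close> that is nonzero on the
  class has constant sign there. Nonvanishing alone does not fix
  that sign, nor the sign of the numerator; the reduction to two points is therefore stated
  for the usual sign convention of fractional programming, in the weak form that some member
  of the class has \<open>E(\<psi>u X) \<ge> 0\<close> and \<open>E(\<psi>l X) > 0\<close>.
  The reduction can fail without this: take \<open>\<mu> = s = 1\<close>,
  \<open>\<phi> x = (x - 1)^2\<close>, \<open>\<psi>u x = -1\<close> and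
  \<open>\<psi>l x = max 0 (\<bar>x - 1\<bar> - 1) - (x - 1) + 5\<close>. The law
  with masses 1/8, 3/4, 1/8 at -1, 1, 3 has ratio -4/21, whereas the supremum over
  two-point laws is \<open>-2 / (9 + sqrt 2)\<close>, which is smaller. Similarly with
  \<open>\<psi>l\<close> constantly -1 and \<open>\<psi>u\<close> equal to 12 minus
  the function above.\<close>

end

theory Submission
  imports Defs
begin

text \<open>
  Let \<open>P\<close> be a law in the ratio class with \<open>E(\<psi>u X) \<ge> 0\<close>. Cut the line into two
  intervals that both carry mass and on each of which \<open>\<psi>u\<close> is concave and \<open>\<psi>l\<close> is
  convex, and move the mass of each interval to its conditional mean. By Jensen's
  inequality on the two intervals (\<open>collapse_piecewise\<close>) the resulting two-point law
  with atoms \<open>v1 < \<mu> < v2\<close> has the same mean, a numerator that is at least as large, a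
  denominator that is at most as large, and \<open>E(\<phi> X) \<le> s\<close>. If the breakpoint \<open>t\<close> separates
  mass of \<open>P\<close>, it is the cut. Otherwise \<open>P\<close> lives on one side of \<open>t\<close>, and the cut is
  made at \<open>\<mu>\<close>: this works because \<open>s > 0\<close> keeps \<open>P\<close> from being the point mass at \<open>\<mu>\<close>.

  The collapsed law may have \<open>E(\<phi> X) < s\<close>. Moving the upper atom to the right with
  \<open>v1\<close> fixed takes \<open>E(\<phi> X)\<close> continuously to infinity, by the growth of \<open>\<phi>\<close>, so
  the value \<open>s\<close> is reached (\<open>two_point_mean_attains\<close>), and by the monotonicity
  of \<open>g_ratio\<close> the ratio does not decrease on the way.

  Comparing the ratios before and after the collapse needs a positive denominator
  after it, although the collapsed law need not lie in the moment class. On the class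
  itself positivity is a mixing argument: of two laws with denominators of opposite sign
  some mixture would have denominator zero (\<open>ratio_class_pos\<close>). For a collapsed law,
  a small amount of a two-point law with a very remote upper atom is mixed in to
  restore \<open>E(\<phi> X) = s\<close>. As \<open>\<psi>l\<close> is bounded above on the right, this small amount can hardly
  raise the denominator, which therefore was not negative to begin with
  (\<open>two_point_denominator_nonneg\<close>); it is nonzero by hypothesis.

  Laws with \<open>E(\<psi>u X) < 0\<close> have negative ratio and lie below the law of nonnegative ratio
  whose existence is assumed. Conversely, the two-point laws of the reduced problem are
  members of the class.
\<close>

section \<open>Mixtures and two-point laws\<close>

text \<open>Drawing from \<open>N\<close> with probability \<open>u\<close> and from \<open>M\<close> otherwise is a Giry-monadic bind
  over a coin toss; integrals of possibly unbounded functions are computed from those of the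
  positive and negative parts.\<close>

lemma law_mixture:
  fixes M N :: "real measure" and u :: real
  assumes "prob_space M" "prob_space N" "sets M = sets borel" "sets N = sets borel"
    and u: "0 \<le> u" "u \<le> 1"
  obtains R where "prob_space R" "sets R = sets borel"
    "\<And>f :: real \<Rightarrow> real. integrable M f \<Longrightarrow> integrable N f \<Longrightarrow>
       integrable R f \<and> integral\<^sup>L R f = (1 - u) * integral\<^sup>L M f + u * integral\<^sup>L N f"
proof -
  define K where "K = (\<lambda>b. if b then N else M)"
  define R where "R = measure_pmf (bernoulli_pmf u) \<bind> K"
  have K: "K \<in> measurable (measure_pmf (bernoulli_pmf u)) (subprob_algebra borel)"
    using assms by (auto simp: K_def space_subprob_algebra prob_space_imp_subprob_space)
  have sets_K: "sets (K b) = sets borel" for b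
    using assms by (simp add: K_def)
  have sets_R: "sets R = sets borel"
    unfolding R_def by (rule sets_bind) (auto simp: sets_K)
  have "prob_space R"
    unfolding R_def
    by (rule prob_space.prob_space_bind[OF _ _ K])
       (auto simp: K_def assms measure_pmf.prob_space_axioms)
  moreover have "integrable R f \<and> integral\<^sup>L R f = (1 - u) * integral\<^sup>L M f + u * integral\<^sup>L N f"
    if fM: "integrable M f" and fN: "integrable N f" for f :: "real \<Rightarrow> real"
  proof -
    have f: "f \<in> borel_measurable borel"
      using borel_measurable_integrable[OF fM] assms(3) by (simp cong: measurable_cong_sets)
    have nn: "(\<integral>\<^sup>+x. ennreal (h x) \<partial>R)
        = (\<integral>\<^sup>+x. ennreal (h x) \<partial>N) * ennreal u + (\<integral>\<^sup>+x. ennreal (h x) \<partial>M) * ennreal (1 - u)"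
      if "h \<in> borel_measurable borel" for h :: "real \<Rightarrow> real"
      unfolding R_def using that u K by (subst nn_integral_bind) (auto simp: K_def)
    have fR: "f \<in> borel_measurable R"
      using f sets_R by (simp cong: measurable_cong_sets)
    have f': "(\<lambda>x. - f x) \<in> borel_measurable borel"
      using f by simp
    have fin: "(\<integral>\<^sup>+x. ennreal (f x) \<partial>M) < \<top>" "(\<integral>\<^sup>+x. ennreal (- f x) \<partial>M) < \<top>"
      "(\<integral>\<^sup>+x. ennreal (f x) \<partial>N) < \<top>" "(\<integral>\<^sup>+x. ennreal (- f x) \<partial>N) < \<top>"
      using fM fN by (auto simp: real_integrable_def less_top)
    have int: "integrable R f"
      using fR fin by (simp add: real_integrable_def nn[OF f] nn[OF f'] ennreal_mult_eq_top_iff less_top[symmetric])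
    have "integral\<^sup>L R f = (1 - u) * integral\<^sup>L M f + u * integral\<^sup>L N f"
      using fin u
      by (simp add: real_lebesgue_integral_def[OF int] real_lebesgue_integral_def[OF fM]
          real_lebesgue_integral_def[OF fN] nn[OF f] nn[OF f'] enn2real_plus ennreal_mult_less_top
          enn2real_mult algebra_simps)
    with int show ?thesis by simp
  qed
  ultimately show thesis using sets_R that by blast
qed

lemma two_point_law:
  assumes "v1 < \<mu>" "\<mu> < v2"
  obtains P where "prob_space P" "sets P = sets borel"
    "\<And>f. f \<in> borel_measurable borel \<Longrightarrow> integrable P f \<and> integral\<^sup>L P f = two_point_mean \<mu> f v1 v2"
proof -
  have w: "0 \<le> weight2 \<mu> v1 v2" "weight2 \<mu> v1 v2 \<le> 1"
    using assms by (auto simp: weight2_def)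
  have ret: "integrable (return borel v) f" if "f \<in> borel_measurable borel" for v and f :: "real \<Rightarrow> real"
    using that by (intro integrableI_bounded) (simp_all add: nn_integral_return)
  obtain P where "prob_space P" "sets P = sets borel"
    and "\<And>f :: real \<Rightarrow> real. integrable (return borel v1) f \<Longrightarrow> integrable (return borel v2) f \<Longrightarrow>
       integrable P f \<and> integral\<^sup>L P f = (1 - weight2 \<mu> v1 v2) * integral\<^sup>L (return borel v1) f
          + weight2 \<mu> v1 v2 * integral\<^sup>L (return borel v2) f"
    by (rule law_mixture[of "return borel v1" "return borel v2" "weight2 \<mu> v1 v2"])
       (use w in \<open>auto intro: prob_space_return\<close>)
  then show thesis
    by (intro that[of P]) (auto simp: ret integral_return two_point_mean_def weight1_def)
qed

section \<open>Collapsing a law onto two points\<close>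

text \<open>Jensen's inequality for the conditional law on an interval that may contain its
  endpoints, where \<open>f\<close> may be discontinuous. If the conditional mean \<open>m\<close> is an interior
  point, a supporting line at \<open>m\<close> is integrated. Otherwise the interval lies
  on one side of \<open>m\<close>, so that all mass in it sits at \<open>m\<close>. Stating the inequality without
  dividing by the mass of \<open>A\<close> makes contributions of disjoint intervals additive.\<close>

lemma jensen_on_convex_set:
  fixes P :: "real measure" and A :: "real set"
  assumes "prob_space P" and sets_P: "sets P = sets borel"
    and int_id: "integrable P (\<lambda>x. x)"
    and A: "A \<in> sets borel" "convex A" and pos: "measure P A > 0"
  defines "m \<equiv> (LINT x:A|P. x) / measure P A"
  shows "m \<in> A"
    and "\<And>f. convex_on A f \<Longrightarrow> integrable P f \<Longrightarrow> measure P A * f m \<le> (LINT x:A|P. f x)"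
proof -
  interpret prob_space P by fact
  have AP: "A \<in> sets P" using A sets_P by simp
  have set_int: "set_integrable P A f" if "integrable P f" for f :: "real \<Rightarrow> real"
    using integrable_mult_indicator[OF AP that] by (simp add: set_integrable_def)
  have const: "set_integrable P A (\<lambda>x. c)" "(LINT x:A|P. c) = measure P A * c" for c :: real
    using set_int[of "\<lambda>x. c"] AP by (auto simp: set_lebesgue_integral_def)
  have centred: "(LINT x:A|P. x - m) = 0"
    using pos by (subst set_integral_diff) (auto simp: set_int int_id const m_def)
  have degenerate: "AE x in P. x \<in> A \<longrightarrow> x = m" if "m \<notin> interior A"
  proof -
    have "(\<forall>x\<in>A. x \<le> m) \<or> (\<forall>x\<in>A. m \<le> x)"
    proof (rule ccontr)
      assume "\<not> ?thesis"
      then obtain a b where ab: "a \<in> A" "b \<in> A" "a < m" "m < b" by force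
      have "{a<..<b} \<subseteq> A"
        using A(2) ab by (metis convex_contains_segment closed_segment_eq_real_ivl greaterThanLessThan_subseteq_atLeastAtMost_iff
            less_imp_le order_trans order_refl less_trans)
      then have "m \<in> interior A"
        using ab by (intro interiorI[of "{a<..<b}"]) auto
      with that show False by simp
    qed
    \<comment> \<open>\<open>c\<close> is 1 or -1, according to the side of \<open>m\<close> on which \<open>A\<close> lies.\<close>
    then obtain c :: real where c: "c \<noteq> 0" "\<And>x. x \<in> A \<Longrightarrow> 0 \<le> c * (x - m)"
      by (metis diff_ge_0_iff_ge minus_diff_eq mult_1 mult_minus1 neg_equal_0_iff_equal zero_neq_one)
    have "integrable P (\<lambda>x. indicator A x * (c * (x - m)))"
      using set_int[of "\<lambda>x. c * (x - m)"] int_id by (simp add: set_integrable_def)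
    moreover have "integral\<^sup>L P (\<lambda>x. indicator A x * (c * (x - m))) = 0"
      using centred by (simp add: set_lebesgue_integral_def mult.left_commute)
    ultimately have "AE x in P. indicator A x * (c * (x - m)) = 0"
      using c by (subst (asm) integral_nonneg_eq_0_iff_AE) (auto simp: indicator_def)
    then show ?thesis using c by (auto simp: indicator_def)
  qed
  show mem: "m \<in> A"
  proof (rule ccontr)
    assume m: "m \<notin> A"
    then have "m \<notin> interior A" using interior_subset by blast
    then have "AE x in P. x \<notin> A"
      using m by (auto dest!: degenerate elim!: eventually_mono)
    then have "measure P A = 0" using AP by (simp add: prob_eq_0)
    with pos show False by simp
  qed
  show "measure P A * f m \<le> (LINT x:A|P. f x)" if f: "convex_on A f" "integrable P f" for f
  proof (cases "m \<in> interior A")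
    case True
    define c where "c = Inf ((\<lambda>t. (f m - f t) / (m - t)) ` ({m<..} \<inter> A))"
    have "(LINT x:A|P. f m + c * (x - m)) \<le> (LINT x:A|P. f x)"
    proof (rule set_integral_mono)
      show "set_integrable P A (\<lambda>x. f m + c * (x - m))"
        using int_id by (intro set_int) simp
      show "f m + c * (x - m) \<le> f x" if "x \<in> A" for x
        using convex_le_Inf_differential[OF f(1) True that] by (simp add: c_def)
    qed (use f set_int in simp)
    moreover have "(LINT x:A|P. f m + c * (x - m)) = measure P A * f m"
      by (subst set_integral_add) (use int_id centred in \<open>auto simp: const intro: set_int\<close>)
    ultimately show ?thesis by simp
  next
    case False
    have "(LINT x:A|P. f x) = (LINT x:A|P. f m)"
      using degenerate[OF False] f AP
      by (intro set_lebesgue_integral_cong_AE) (auto elim!: eventually_mono)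
    then show ?thesis by (simp add: const)
  qed
qed

text \<open>The atoms are the conditional means of the two intervals. Preservation of the mean forces
  the masses of the intervals to be the weights of \<open>two_point_mean\<close>.\<close>

lemma collapse_to_two_points:
  fixes P :: "real measure" and A B :: "real set"
  assumes "prob_space P" and sets_P: "sets P = sets borel"
    and mean: "integrable P (\<lambda>x. x)" "integral\<^sup>L P (\<lambda>x. x) = \<mu>"
    and A: "A \<in> sets borel" "convex A" "measure P A > 0"
    and B: "B \<in> sets borel" "convex B" "measure P B > 0"
    and below: "\<And>a b. a \<in> A \<Longrightarrow> b \<in> B \<Longrightarrow> a < b"
    and cover: "AE x in P. x \<in> A \<union> B"
  obtains v1 v2 where "v1 < \<mu>" "\<mu> < v2"
    "\<And>f. convex_on A f \<Longrightarrow> convex_on B f \<Longrightarrow> integrable P f \<Longrightarrow>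
       two_point_mean \<mu> f v1 v2 \<le> integral\<^sup>L P f"
proof -
  interpret prob_space P by fact
  have AB: "A \<in> sets P" "B \<in> sets P" "A \<inter> B = {}"
    using A B below sets_P by force+
  have total: "integral\<^sup>L P f = (LINT x:A|P. f x) + (LINT x:B|P. f x)" if "integrable P f" for f :: "real \<Rightarrow> real"
  proof -
    have "integral\<^sup>L P f = (LINT x:A \<union> B|P. f x)"
      unfolding set_lebesgue_integral_def using AB that cover
      by (intro integral_cong_AE) (auto elim!: eventually_mono)
    also have "\<dots> = (LINT x:A|P. f x) + (LINT x:B|P. f x)"
      using AB that by (intro set_integral_Un) (auto simp: set_integrable_def intro: integrable_mult_indicator[of _ _ f, simplified])
    finally show ?thesis .
  qed
  define p q where "p = measure P A" and "q = measure P B"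
  define v1 v2 where "v1 = (LINT x:A|P. x) / p" and "v2 = (LINT x:B|P. x) / q"
  have pos: "p > 0" "q > 0" using A B by (auto simp: p_def q_def)
  have "p + q = measure P (A \<union> B)"
    using AB by (simp add: p_def q_def finite_measure_Union)
  then have pq: "p + q = 1"
    using cover AB by (simp add: prob_eq_1)
  have v: "v1 \<in> A" "v2 \<in> B"
    using jensen_on_convex_set(1)[OF assms(1) sets_P mean(1) A]
      jensen_on_convex_set(1)[OF assms(1) sets_P mean(1) B] by (simp_all add: v1_def v2_def p_def q_def)
  then have "v1 < v2" by (rule below)
  have mu: "\<mu> = p * v1 + q * v2"
    using total[OF mean(1)] mean(2) pos by (simp add: v1_def v2_def)
  have "p = 1 - q" "q = 1 - p" using pq by simp_all
  then have mu': "\<mu> = v1 + q * (v2 - v1)" "\<mu> = v2 - p * (v2 - v1)"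
    unfolding mu by algebra+
  have w: "weight2 \<mu> v1 v2 = q" "weight1 \<mu> v1 v2 = p"
    using mu'(1) \<open>v1 < v2\<close> pq by (auto simp: weight2_def weight1_def)
  show thesis
  proof (rule that[of v1 v2])
    show "v1 < \<mu>" "\<mu> < v2"
      using mu' pos \<open>v1 < v2\<close> by (smt (verit) mult_pos_pos)+
    fix f assume f: "convex_on A f" "convex_on B f" "integrable P f"
    have "p * f v1 \<le> (LINT x:A|P. f x)" "q * f v2 \<le> (LINT x:B|P. f x)"
      using jensen_on_convex_set(2)[OF assms(1) sets_P mean(1) A f(1,3)]
        jensen_on_convex_set(2)[OF assms(1) sets_P mean(1) B f(2,3)]
      by (simp_all add: v1_def v2_def p_def q_def)
    then show "two_point_mean \<mu> f v1 v2 \<le> integral\<^sup>L P f"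
      using total[OF f(3)] by (simp add: two_point_mean_def w)
  qed
qed

text \<open>The atoms do not depend on \<open>f\<close>, so the same two-point law serves \<open>\<phi>\<close>, \<open>\<psi>l\<close> and
  \<open>- \<psi>u\<close> at once.\<close>

lemma collapse_piecewise:
  fixes P :: "real measure" and t :: real
  assumes "prob_space P" and sets_P: "sets P = sets borel"
    and mean: "integrable P (\<lambda>x. x)" "integral\<^sup>L P (\<lambda>x. x) = \<mu>"
    and nondeg: "\<not> (AE x in P. x = \<mu>)"
  obtains v1 v2 where "v1 < \<mu>" "\<mu> < v2"
    "\<And>f. convex_on {x. x < t} f \<Longrightarrow> convex_on {x. x \<ge> t} f \<Longrightarrow> integrable P f \<Longrightarrow>
       two_point_mean \<mu> f v1 v2 \<le> integral\<^sup>L P f"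
proof -
  interpret prob_space P by fact
  note atoms = that
  have meas: "{x. x < c} \<in> sets P" "{x. x \<ge> c} \<in> sets P" for c :: real
    by (simp_all add: sets_P)
  have null: "measure P S = 0 \<longleftrightarrow> (AE x in P. x \<notin> S)" if "S \<in> sets P" for S
    using that by (rule prob_eq_0)
  have conv: "convex {x::real. x < c}" "convex {x::real. x \<ge> c}" for c
    by (simp_all add: lessThan_def[symmetric] atLeast_def[symmetric])
  have centred: "integral\<^sup>L P (\<lambda>x. x - \<mu>) = 0" "integral\<^sup>L P (\<lambda>x. \<mu> - x) = 0"
    using mean by (simp_all add: prob_space)
  have lo: "\<not> (AE x in P. x \<notin> {x. x < \<mu>})"
  proof
    assume "AE x in P. x \<notin> {x. x < \<mu>}"
    then have "AE x in P. 0 \<le> x - \<mu>" by (auto elim!: eventually_mono)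
    then have "AE x in P. x - \<mu> = 0"
      using centred mean integral_nonneg_eq_0_iff_AE[of P "\<lambda>x. x - \<mu>"] by simp
    with nondeg show False by simp
  qed
  have hi: "\<not> (AE x in P. x \<notin> {x. x \<ge> \<mu>})"
  proof
    assume *: "AE x in P. x \<notin> {x. x \<ge> \<mu>}"
    then have "AE x in P. 0 \<le> \<mu> - x" by (auto elim!: eventually_mono)
    then have "AE x in P. \<mu> - x = 0"
      using centred mean integral_nonneg_eq_0_iff_AE[of P "\<lambda>x. \<mu> - x"] by simp
    then have "AE x in P. x = \<mu>" by (rule eventually_mono) simp
    with nondeg show False ..
  qed
  have positive: "measure P S > 0" if "\<not> (AE x in P. x \<notin> S)" "S \<in> sets P" for S
    using null[OF that(2)] that(1) by (simp add: less_le)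
  \<comment> \<open>For a law living on a single piece, that piece is cut at the mean, where both sides
     carry mass.\<close>
  have one_sided: thesis
    if S: "S \<in> sets borel" "convex S" "AE x in P. x \<in> S"
      and sub: "S \<subseteq> {x. x < t} \<or> S \<subseteq> {x. x \<ge> t}" for S
  proof -
    have charged: "\<not> (AE x in P. x \<notin> S \<inter> {x. x < \<mu>})" "\<not> (AE x in P. x \<notin> S \<inter> {x. x \<ge> \<mu>})"
      using lo hi by (auto dest: AE_mp[OF S(3)])
    have conv_cells: "convex (S \<inter> {x. x < \<mu>})" "convex (S \<inter> {x. x \<ge> \<mu>})"
      by (rule convex_Int[OF S(2) conv(1)], rule convex_Int[OF S(2) conv(2)])
    have borel_cells: "S \<inter> {x. x < \<mu>} \<in> sets borel" "S \<inter> {x. x \<ge> \<mu>} \<in> sets borel"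
      by (rule sets.Int[OF S(1)], simp)+
    have cells: "measure P (S \<inter> {x. x < \<mu>}) > 0" "measure P (S \<inter> {x. x \<ge> \<mu>}) > 0"
      using positive[OF charged(1)] positive[OF charged(2)] borel_cells unfolding sets_P by blast+
    have cover: "AE x in P. x \<in> S \<inter> {x. x < \<mu>} \<union> S \<inter> {x. x \<ge> \<mu>}"
      using S(3) by (auto elim!: eventually_mono)
    obtain v1 v2 where v: "v1 < \<mu>" "\<mu> < v2"
      and *: "\<And>f. convex_on (S \<inter> {x. x < \<mu>}) f \<Longrightarrow> convex_on (S \<inter> {x. x \<ge> \<mu>}) f \<Longrightarrow>
        integrable P f \<Longrightarrow> two_point_mean \<mu> f v1 v2 \<le> integral\<^sup>L P f"
      by (rule collapse_to_two_points[OF assms(1) sets_P mean borel_cells(1) conv_cells(1) cells(1)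
            borel_cells(2) conv_cells(2) cells(2) _ cover]) auto
    have "two_point_mean \<mu> f v1 v2 \<le> integral\<^sup>L P f"
      if "convex_on {x. x < t} f" "convex_on {x. x \<ge> t} f" "integrable P f" for f
    proof (rule *)
      have "convex_on S f"
        using sub convex_on_subset[OF that(1) _ S(2)] convex_on_subset[OF that(2) _ S(2)] by blast
      then show "convex_on (S \<inter> {x. x < \<mu>}) f" "convex_on (S \<inter> {x. x \<ge> \<mu>}) f"
        using conv_cells by (blast intro: convex_on_subset)+
    qed fact
    then show thesis by (rule atoms[OF v])
  qed
  show thesis
  proof (cases "(AE x in P. x < t) \<or> (AE x in P. x \<ge> t)")
    case True
    then show thesis
    proof
      assume "AE x in P. x < t"
      then show thesis
        using conv(1) by (intro one_sided[of "{x. x < t}"]) simp_all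
    next
      assume "AE x in P. x \<ge> t"
      then show thesis
        using conv(2) by (intro one_sided[of "{x. x \<ge> t}"]) simp_all
    qed
  next
    case False
    then have cells: "measure P {x. x < t} > 0" "measure P {x. x \<ge> t} > 0"
      using positive[OF _ meas(1)] positive[OF _ meas(2)] by (simp_all add: not_less not_le)
    have borel_cells: "{x. x < t} \<in> sets borel" "{x. x \<ge> t} \<in> sets borel" by simp_all
    have cover: "AE x in P. x \<in> {x. x < t} \<union> {x. x \<ge> t}" by (intro AE_I2) auto
    show thesis
      by (rule collapse_to_two_points[OF assms(1) sets_P mean borel_cells(1) conv(1) cells(1)
            borel_cells(2) conv(2) cells(2) _ cover]) (auto intro: atoms)
  qed
qed

section \<open>Moving the upper atom\<close>

text \<open>The weight of the upper atom \<open>x\<close> is \<open>(\<mu> - v1) / (x - v1)\<close>, of the order of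
  \<open>1 / x\<close>, so its contribution is comparable to \<open>\<phi> x / x\<close>.\<close>

lemma two_point_mean_at_top:
  fixes \<phi> :: "real \<Rightarrow> real"
  assumes growth: "filterlim (\<lambda>x. \<bar>\<phi> x / x\<bar>) at_top at_infinity"
    and nonneg: "\<And>x. 0 \<le> \<phi> x" and v1: "v1 < \<mu>"
  shows "filterlim (two_point_mean \<mu> \<phi> v1) at_top at_top"
proof (rule filterlim_at_top_mono)
  have "filterlim (\<lambda>x. \<bar>\<phi> x / x\<bar>) at_top at_top"
    using growth at_top_le_at_infinity by (rule filterlim_mono[OF _ order_refl])
  then show "filterlim (\<lambda>x. (\<mu> - v1) / 2 * \<bar>\<phi> x / x\<bar>) at_top at_top"
    using v1 by (intro filterlim_tendsto_pos_mult_at_top[OF tendsto_const]) auto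
  show "\<forall>\<^sub>F x in at_top. (\<mu> - v1) / 2 * \<bar>\<phi> x / x\<bar> \<le> two_point_mean \<mu> \<phi> v1 x"
    using eventually_gt_at_top[of "max \<mu> \<bar>v1\<bar>"]
  proof eventually_elim
    case (elim x)
    then have x: "\<mu> < x" "v1 < x" "0 < x" "x - v1 \<le> 2 * x" by auto
    have "(\<mu> - v1) / 2 * \<bar>\<phi> x / x\<bar> = (\<mu> - v1) * \<phi> x / (2 * x)"
      using x nonneg[of x] by simp
    also have "\<dots> \<le> (\<mu> - v1) * \<phi> x / (x - v1)"
      using x v1 nonneg[of x] by (intro divide_left_mono) auto
    also have "\<dots> \<le> two_point_mean \<mu> \<phi> v1 x"
      using x v1 nonneg[of v1] by (simp add: two_point_mean_def weight1_def weight2_def)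
    finally show ?case .
  qed
qed

lemma two_point_mean_attains:
  fixes \<phi> :: "real \<Rightarrow> real"
  assumes cont: "continuous_on UNIV \<phi>"
    and lim: "filterlim (two_point_mean \<mu> \<phi> v1) at_top at_top"
    and v: "v1 < \<mu>" "\<mu> < v2" "two_point_mean \<mu> \<phi> v1 v2 \<le> s"
  obtains v3 where "v2 \<le> v3" "two_point_mean \<mu> \<phi> v1 v3 = s"
proof -
  have "\<forall>\<^sub>F x in at_top. s \<le> two_point_mean \<mu> \<phi> v1 x \<and> v2 \<le> x"
    using lim eventually_ge_at_top[of v2] by (auto simp: filterlim_at_top intro: eventually_conj)
  then obtain V where V: "s \<le> two_point_mean \<mu> \<phi> v1 V" "v2 \<le> V"
    by (auto dest: eventually_happens'[rotated])
  have "continuous_on {v2..V} (two_point_mean \<mu> \<phi> v1)"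
    unfolding two_point_mean_def weight1_def weight2_def using v
    by (intro continuous_intros continuous_on_subset[OF cont]) auto
  from IVT'[OF v(3) V this] show thesis using that by auto
qed

lemma two_point_mean_ident:
  assumes "v1 < v2"
  shows "two_point_mean \<mu> (\<lambda>x. x) v1 v2 = \<mu>"
proof -
  have "weight2 \<mu> v1 v2 * (v2 - v1) = \<mu> - v1"
    using assms by (simp add: weight2_def)
  then show ?thesis
    unfolding two_point_mean_def weight1_def by algebra
qed

text \<open>The mean constraint determines the weights, so the reduced problem has only the atoms
  as variables and its objective is \<open>g_ratio\<close>.\<close>

lemma two_point_ratios_eq:
  "two_point_ratios \<mu> s \<phi> \<psi>u \<psi>l =
     {g_ratio \<mu> \<psi>u \<psi>l v1 v2 | v1 v2. v1 < \<mu> \<and> \<mu> < v2 \<and> two_point_mean \<mu> \<phi> v1 v2 = s}"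
  (is "?L = ?R")
proof (intro set_eqI iffI)
  fix r
  assume "r \<in> ?L"
  then obtain w1 w2 v1 v2 where r: "r = (w1 * \<psi>u v1 + w2 * \<psi>u v2) / (w1 * \<psi>l v1 + w2 * \<psi>l v2)"
    and v: "v1 < \<mu>" "\<mu> < v2" and w: "w1 + w2 = 1" "w1 * v1 + w2 * v2 = \<mu>"
    and s: "w1 * \<phi> v1 + w2 * \<phi> v2 = s"
    unfolding two_point_ratios_def by blast
  have w1: "w1 = 1 - w2" using w(1) by simp
  then have "w2 * (v2 - v1) = \<mu> - v1" using w(2) by algebra
  then have "weight2 \<mu> v1 v2 = w2"
    using v by (simp add: weight2_def nonzero_divide_eq_eq)
  then have "weight2 \<mu> v1 v2 = w2" "weight1 \<mu> v1 v2 = w1"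
    by (simp_all add: w1 weight1_def)
  with v r s show "r \<in> ?R"
    unfolding g_ratio_def two_point_mean_def by (intro CollectI exI[of _ v1] exI[of _ v2]) simp
next
  fix r
  assume "r \<in> ?R"
  then obtain v1 v2 where v: "v1 < \<mu>" "\<mu> < v2" "two_point_mean \<mu> \<phi> v1 v2 = s"
    and r: "r = g_ratio \<mu> \<psi>u \<psi>l v1 v2"
    by blast
  have "0 \<le> weight1 \<mu> v1 v2" "0 \<le> weight2 \<mu> v1 v2" "weight1 \<mu> v1 v2 + weight2 \<mu> v1 v2 = 1"
    using v by (auto simp: weight1_def weight2_def)
  with v r two_point_mean_ident[of v1 v2 \<mu>] show "r \<in> ?L"
    unfolding two_point_ratios_def g_ratio_def two_point_mean_def
    by (intro CollectI exI[of _ "weight1 \<mu> v1 v2"] exI[of _ "weight2 \<mu> v1 v2"] exI[of _ v1] exI[of _ v2]) simp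
qed

section \<open>The sign of the denominator\<close>

lemma ratio_class_pos:
  assumes denom: "\<And>P. P \<in> ratio_class \<mu> s \<phi> \<psi>u \<psi>l \<Longrightarrow> integral\<^sup>L P \<psi>l \<noteq> 0"
    and Q: "Q \<in> ratio_class \<mu> s \<phi> \<psi>u \<psi>l" "integral\<^sup>L Q \<psi>l > 0"
    and P: "P \<in> ratio_class \<mu> s \<phi> \<psi>u \<psi>l"
  shows "integral\<^sup>L P \<psi>l > 0"
proof (rule ccontr)
  assume "\<not> ?thesis"
  with denom[OF P] have neg: "integral\<^sup>L P \<psi>l < 0" by simp
  \<comment> \<open>The mixing weight at which the two denominators cancel.\<close>
  define u where "u = integral\<^sup>L Q \<psi>l / (integral\<^sup>L Q \<psi>l - integral\<^sup>L P \<psi>l)"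
  have u: "0 \<le> u" "u \<le> 1" "(1 - u) * integral\<^sup>L Q \<psi>l + u * integral\<^sup>L P \<psi>l = 0"
    using neg Q(2) by (auto simp: u_def field_simps)
  note [simp] = ratio_class_def moment_class_def
  obtain R where R: "prob_space R" "sets R = sets borel"
    "\<And>f :: real \<Rightarrow> real. integrable Q f \<Longrightarrow> integrable P f \<Longrightarrow>
       integrable R f \<and> integral\<^sup>L R f = (1 - u) * integral\<^sup>L Q f + u * integral\<^sup>L P f"
    by (rule law_mixture[of Q P u]) (use P Q u in auto)
  have fixed: "integral\<^sup>L R f = c"
    if "integrable Q f" "integrable P f" "integral\<^sup>L Q f = c" "integral\<^sup>L P f = c"
    for f :: "real \<Rightarrow> real" and c
    using R(3)[OF that(1,2)] that(3,4) by (simp add: algebra_simps)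
  have "R \<in> ratio_class \<mu> s \<phi> \<psi>u \<psi>l"
    using R(1,2) R(3)[THEN conjunct1] P Q by (simp add: fixed)
  moreover have "integral\<^sup>L R \<psi>l = 0"
    using R(3)[of \<psi>l] P Q u by simp
  ultimately show False using denom by blast
qed

text \<open>If the denominator at \<open>v1\<close>, \<open>v2\<close> were \<open>-d < 0\<close>, mix in with weight \<open>u\<close> the law
  with atoms \<open>v1\<close> and a remote \<open>V\<close>, choosing \<open>u\<close> to bring the \<open>\<phi>\<close>-moment to \<open>s\<close>.
  Then \<open>u\<close> tends to 0 as \<open>V\<close> grows, while the denominator of the remote law stays
  below a constant \<open>B\<close>. So the mixture is a member of the ratio class with a negative
  denominator, a contradiction.\<close>

lemma two_point_denominator_nonneg:
  assumes meas: "\<phi> \<in> borel_measurable borel" "\<psi>u \<in> borel_measurable borel" "\<psi>l \<in> borel_measurable borel"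
    and pos: "\<And>P. P \<in> ratio_class \<mu> s \<phi> \<psi>u \<psi>l \<Longrightarrow> integral\<^sup>L P \<psi>l > 0"
    and lim: "filterlim (two_point_mean \<mu> \<phi> v1) at_top at_top"
    and bdd: "\<And>x. t \<le> x \<Longrightarrow> \<psi>l x \<le> b"
    and v: "v1 < \<mu>" "\<mu> < v2" "two_point_mean \<mu> \<phi> v1 v2 \<le> s"
  shows "two_point_mean \<mu> \<psi>l v1 v2 \<ge> 0"
proof (rule ccontr)
  assume neg: "\<not> ?thesis"
  define d where "d = - two_point_mean \<mu> \<psi>l v1 v2"
  define e where "e = s - two_point_mean \<mu> \<phi> v1 v2"
  define B where "B = \<bar>\<psi>l v1\<bar> + \<bar>b\<bar>"
  have d: "d > 0" using neg by (simp add: d_def)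
  have e: "e \<ge> 0" using v by (simp add: e_def)
  have B: "B \<ge> 0" by (simp add: B_def)
  \<comment> \<open>The threshold makes \<open>u * (d + B) < d\<close>; the summand 1 makes the inequality strict
     and covers \<open>e = 0\<close>, where \<open>u = 0\<close>.\<close>
  have "\<forall>\<^sub>F x in at_top. two_point_mean \<mu> \<phi> v1 v2 + e * (d + B) / d + 1 \<le> two_point_mean \<mu> \<phi> v1 x
      \<and> max t v2 \<le> x"
    using lim eventually_ge_at_top[of "max t v2"] by (auto simp: filterlim_at_top intro: eventually_conj)
  then obtain V where V: "two_point_mean \<mu> \<phi> v1 v2 + e * (d + B) / d + 1 \<le> two_point_mean \<mu> \<phi> v1 V"
      "t \<le> V" "v2 \<le> V"
    by (auto dest: eventually_happens'[rotated])
  define D where "D = two_point_mean \<mu> \<phi> v1 V - two_point_mean \<mu> \<phi> v1 v2"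
  define u where "u = e / D"
  have "e \<le> e * (d + B) / d" using d e B by (simp add: field_simps)
  then have D: "e * (d + B) / d < D" "0 < D" "e \<le> D"
    using V e by (auto simp: D_def)
  have u: "0 \<le> u" "u \<le> 1" using e D by (auto simp: u_def)
  have "e * (d + B) < D * d" using D(1) d by (simp add: field_simps)
  then have small: "u * (d + B) < d" using D by (simp add: u_def field_simps)
  have L: "two_point_mean \<mu> \<psi>l v1 V \<le> B"
  proof -
    have w: "0 \<le> weight2 \<mu> v1 V" "weight2 \<mu> v1 V \<le> 1"
      using v V by (auto simp: weight2_def)
    have scale: "w * y \<le> \<bar>c\<bar>" if "0 \<le> w" "w \<le> 1" "y \<le> c" for w y c :: real
    proof -
      have "w * y \<le> w * \<bar>c\<bar>" using that by (intro mult_left_mono) auto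
      also have "\<dots> \<le> \<bar>c\<bar>" using that by (intro mult_left_le_one_le) auto
      finally show ?thesis .
    qed
    have "weight1 \<mu> v1 V * \<psi>l v1 \<le> \<bar>\<psi>l v1\<bar>"
      using w by (intro scale) (auto simp: weight1_def)
    moreover have "weight2 \<mu> v1 V * \<psi>l V \<le> \<bar>b\<bar>"
      using w bdd[OF V(2)] by (intro scale) auto
    ultimately show ?thesis by (simp add: two_point_mean_def B_def)
  qed
  obtain M where M: "prob_space M" "sets M = sets borel"
    "\<And>f. f \<in> borel_measurable borel \<Longrightarrow> integrable M f \<and> integral\<^sup>L M f = two_point_mean \<mu> f v1 v2"
    using two_point_law[OF v(1,2)] by blast
  obtain N where N: "prob_space N" "sets N = sets borel"
    "\<And>f. f \<in> borel_measurable borel \<Longrightarrow> integrable N f \<and> integral\<^sup>L N f = two_point_mean \<mu> f v1 V"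
    using two_point_law[of v1 \<mu> V] v V(3) by auto
  obtain R where R: "prob_space R" "sets R = sets borel"
    "\<And>f :: real \<Rightarrow> real. integrable M f \<Longrightarrow> integrable N f \<Longrightarrow>
       integrable R f \<and> integral\<^sup>L R f = (1 - u) * integral\<^sup>L M f + u * integral\<^sup>L N f"
    using law_mixture[OF M(1) N(1) M(2) N(2) u] by blast
  have ER: "integrable R f \<and> integral\<^sup>L R f
      = (1 - u) * two_point_mean \<mu> f v1 v2 + u * two_point_mean \<mu> f v1 V"
    if "f \<in> borel_measurable borel" for f
    using R(3)[of f] M(3)[OF that] N(3)[OF that] by simp
  have "integral\<^sup>L R (\<lambda>x. x) = \<mu>"
    using ER[of "\<lambda>x. x"] v V by (simp add: two_point_mean_ident algebra_simps)
  moreover have "integral\<^sup>L R \<phi> = s"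
  proof -
    have "u * D = e" using D by (simp add: u_def)
    then show ?thesis using ER[OF meas(1)] by (simp add: D_def e_def algebra_simps)
  qed
  ultimately have "R \<in> ratio_class \<mu> s \<phi> \<psi>u \<psi>l"
    using ER meas R(1,2) by (simp add: ratio_class_def moment_class_def)
  then have "0 < integral\<^sup>L R \<psi>l" by (rule pos)
  also have "\<dots> = - d + u * (d + two_point_mean \<mu> \<psi>l v1 V)"
    using ER[OF meas(3)] by (simp add: d_def algebra_simps)
  also have "\<dots> \<le> - d + u * (d + B)"
    using L u by (intro add_left_mono mult_left_mono) auto
  finally show False using small by simp
qed

section \<open>The reduction to two points\<close>

lemma borel_measurable_mono_pieces:
  fixes f :: "real \<Rightarrow> real"
  assumes "mono_on {x. x < t} f" "mono_on {x. x \<ge> t} f"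
  shows "f \<in> borel_measurable borel"
proof (rule borel_measurable_piecewise_mono)
  show "countable {{x. x < t}, {x. x \<ge> t}}" by simp
  show "c \<in> sets borel" "mono_on c f" if "c \<in> {{x. x < t}, {x. x \<ge> t}}" for c
    using that assms by (elim insertE emptyE; simp)+
  show "\<Union> {{x. x < t}, {x. x \<ge> t}} = UNIV" by auto
qed

theorem theorem2p1:
  fixes \<mu> s :: real and \<phi> \<psi>u \<psi>l :: "real \<Rightarrow> real"
  assumes mu_pos: "\<mu> > 0" and s_pos: "s > 0"
    and phi_convex: "strictly_convex \<phi>"
    and phi_diff: "\<And>x. x \<noteq> \<mu> \<Longrightarrow> \<phi> differentiable (at x)"
    and phi_growth: "filterlim (\<lambda>x. \<bar>\<phi> x / x\<bar>) at_top at_infinity"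
    and phi_zero: "\<phi> \<mu> = 0"
    and phi_min: "\<And>x. \<phi> \<mu> \<le> \<phi> x"
    and pieces: "\<exists>t. concave_on {x. x < t} \<psi>u \<and> mono_on {x. x < t} \<psi>u \<and>
                     concave_on {x. x \<ge> t} \<psi>u \<and> mono_on {x. x \<ge> t} \<psi>u \<and>
                     convex_on {x. x < t} \<psi>l \<and> antimono_on {x. x < t} \<psi>l \<and>
                     convex_on {x. x \<ge> t} \<psi>l \<and> antimono_on {x. x \<ge> t} \<psi>l"
    and g_mono: "\<And>v1. v1 < \<mu> \<Longrightarrow> mono_on {\<mu><..} (\<lambda>v2. g_ratio \<mu> \<psi>u \<psi>l v1 v2)"
    and g_denom: "\<And>v1 v2. v1 < \<mu> \<Longrightarrow> \<mu> < v2 \<Longrightarrow> two_point_mean \<mu> \<psi>l v1 v2 \<noteq> 0"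
    and denom: "\<And>P. P \<in> ratio_class \<mu> s \<phi> \<psi>u \<psi>l \<Longrightarrow> integral\<^sup>L P \<psi>l \<noteq> 0"
    and sign: "\<exists>P \<in> ratio_class \<mu> s \<phi> \<psi>u \<psi>l. integral\<^sup>L P \<psi>u \<ge> 0 \<and> integral\<^sup>L P \<psi>l > 0"
  shows "(SUP P \<in> ratio_class \<mu> s \<phi> \<psi>u \<psi>l. ereal (integral\<^sup>L P \<psi>u / integral\<^sup>L P \<psi>l))
       = (SUP r \<in> two_point_ratios \<mu> s \<phi> \<psi>u \<psi>l. ereal r)"
proof -
  obtain t where u_lo: "concave_on {x. x < t} \<psi>u" "mono_on {x. x < t} \<psi>u"
    and u_hi: "concave_on {x. x \<ge> t} \<psi>u" "mono_on {x. x \<ge> t} \<psi>u"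
    and l_lo: "convex_on {x. x < t} \<psi>l" "antimono_on {x. x < t} \<psi>l"
    and l_hi: "convex_on {x. x \<ge> t} \<psi>l" "antimono_on {x. x \<ge> t} \<psi>l"
    using pieces by blast
  have phi_nonneg: "0 \<le> \<phi> x" for x using phi_min[of x] phi_zero by simp
  have phi_conv: "convex_on UNIV \<phi>"
  proof (intro convex_onI)
    fix u x y :: real
    assume "0 < u" "u < 1"
    then show "\<phi> ((1 - u) *\<^sub>R x + u *\<^sub>R y) \<le> (1 - u) * \<phi> x + u * \<phi> y"
    proof (cases "x = y")
      case True
      then show ?thesis by (simp add: scaleR_left_diff_distrib left_diff_distrib)
    next
      case False
      with \<open>0 < u\<close> \<open>u < 1\<close> have "\<phi> ((1 - u) * x + u * y) < (1 - u) * \<phi> x + u * \<phi> y"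
        using phi_convex unfolding strictly_convex_def by blast
      then show ?thesis by simp
    qed
  qed simp
  have phi_cont: "continuous_on UNIV \<phi>"
    by (rule convex_on_continuous[OF open_UNIV phi_conv])
  have meas_phi: "\<phi> \<in> borel_measurable borel"
    using phi_cont by (rule borel_measurable_continuous_onI)
  have meas_u: "\<psi>u \<in> borel_measurable borel"
    using u_lo(2) u_hi(2) by (rule borel_measurable_mono_pieces)
  have "(\<lambda>x. - \<psi>l x) \<in> borel_measurable borel"
    using l_lo(2) l_hi(2) by (intro borel_measurable_mono_pieces[of t]) (auto simp: monotone_on_def)
  then have meas_l: "\<psi>l \<in> borel_measurable borel"
    by (simp only: borel_measurable_uminus_eq)
  have lim: "filterlim (two_point_mean \<mu> \<phi> v1) at_top at_top" if "v1 < \<mu>" for v1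
    using two_point_mean_at_top[OF phi_growth phi_nonneg that] .
  obtain P0 where P0: "P0 \<in> ratio_class \<mu> s \<phi> \<psi>u \<psi>l" "integral\<^sup>L P0 \<psi>u \<ge> 0" "integral\<^sup>L P0 \<psi>l > 0"
    using sign by blast
  have pos: "integral\<^sup>L P \<psi>l > 0" if "P \<in> ratio_class \<mu> s \<phi> \<psi>u \<psi>l" for P
    using ratio_class_pos[OF denom P0(1,3) that] .
  have reduce: "\<exists>r \<in> two_point_ratios \<mu> s \<phi> \<psi>u \<psi>l. integral\<^sup>L P \<psi>u / integral\<^sup>L P \<psi>l \<le> r"
    if P: "P \<in> ratio_class \<mu> s \<phi> \<psi>u \<psi>l" and nonneg: "integral\<^sup>L P \<psi>u \<ge> 0" for P
  proof -
    have law: "prob_space P" "sets P = sets borel" "integrable P (\<lambda>x. x)" "integral\<^sup>L P (\<lambda>x. x) = \<mu>"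
      "integrable P \<phi>" "integral\<^sup>L P \<phi> = s" "integrable P \<psi>u" "integrable P \<psi>l"
      using P by (simp_all add: ratio_class_def moment_class_def)
    \<comment> \<open>The point mass at \<open>\<mu>\<close> has \<open>\<phi>\<close>-moment 0.\<close>
    have "\<not> (AE x in P. x = \<mu>)"
    proof
      assume "AE x in P. x = \<mu>"
      then have "AE x in P. \<phi> x = 0"
        by (rule eventually_mono) (simp add: phi_zero)
      then have "integral\<^sup>L P \<phi> = 0" by (rule integral_eq_zero_AE)
      with s_pos law(6) show False by simp
    qed
    from collapse_piecewise[OF law(1-4) this] obtain v1 v2 where v: "v1 < \<mu>" "\<mu> < v2"
      and jensen: "\<And>f. convex_on {x. x < t} f \<Longrightarrow> convex_on {x. x \<ge> t} f \<Longrightarrow> integrable P f \<Longrightarrow>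
        two_point_mean \<mu> f v1 v2 \<le> integral\<^sup>L P f"
      by blast
    have phi_le: "two_point_mean \<mu> \<phi> v1 v2 \<le> s"
      using jensen[OF convex_on_subset[OF phi_conv subset_UNIV] convex_on_subset[OF phi_conv subset_UNIV]
          law(5)] law(6) l_lo(1) l_hi(1) by (simp add: convex_on_imp_convex)
    have l_le: "two_point_mean \<mu> \<psi>l v1 v2 \<le> integral\<^sup>L P \<psi>l"
      by (rule jensen[OF l_lo(1) l_hi(1) law(8)])
    have "two_point_mean \<mu> (\<lambda>x. - \<psi>u x) v1 v2 \<le> integral\<^sup>L P (\<lambda>x. - \<psi>u x)"
      using u_lo(1) u_hi(1) law(7) by (intro jensen) (simp_all add: concave_on_def)
    then have u_ge: "integral\<^sup>L P \<psi>u \<le> two_point_mean \<mu> \<psi>u v1 v2"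
      by (simp add: two_point_mean_def)
    have "two_point_mean \<mu> \<psi>l v1 v2 \<ge> 0"
    proof (rule two_point_denominator_nonneg[OF meas_phi meas_u meas_l pos lim[OF v(1)] _ v phi_le])
      show "\<psi>l x \<le> \<psi>l t" if "t \<le> x" for x
        using l_hi(2) that by (auto simp: monotone_on_def)
    qed
    then have l_pos: "two_point_mean \<mu> \<psi>l v1 v2 > 0"
      using g_denom[OF v] by simp
    obtain v3 where v3: "v2 \<le> v3" "two_point_mean \<mu> \<phi> v1 v3 = s"
      using two_point_mean_attains[OF phi_cont lim[OF v(1)] v phi_le] .
    have "integral\<^sup>L P \<psi>u / integral\<^sup>L P \<psi>l \<le> g_ratio \<mu> \<psi>u \<psi>l v1 v2"
      unfolding g_ratio_def using u_ge l_le l_pos nonneg by (intro frac_le) auto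
    also have "\<dots> \<le> g_ratio \<mu> \<psi>u \<psi>l v1 v3"
      using g_mono[OF v(1)] v v3 by (auto simp: monotone_on_def)
    finally show ?thesis
      using v v3 unfolding two_point_ratios_eq by fastforce
  qed
  have upper: "\<exists>r \<in> two_point_ratios \<mu> s \<phi> \<psi>u \<psi>l. integral\<^sup>L P \<psi>u / integral\<^sup>L P \<psi>l \<le> r"
    if P: "P \<in> ratio_class \<mu> s \<phi> \<psi>u \<psi>l" for P
  proof (cases "integral\<^sup>L P \<psi>u \<ge> 0")
    case False
    then have "integral\<^sup>L P \<psi>u / integral\<^sup>L P \<psi>l \<le> 0"
      using pos[OF P] by (simp add: divide_le_0_iff)
    also have "\<dots> \<le> integral\<^sup>L P0 \<psi>u / integral\<^sup>L P0 \<psi>l" using P0 by simp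
    finally show ?thesis using reduce[OF P0(1,2)] by (meson order_trans)
  qed (rule reduce[OF P])
  have lower: "\<exists>P \<in> ratio_class \<mu> s \<phi> \<psi>u \<psi>l. r = integral\<^sup>L P \<psi>u / integral\<^sup>L P \<psi>l"
    if r: "r \<in> two_point_ratios \<mu> s \<phi> \<psi>u \<psi>l" for r
  proof -
    obtain v1 v2 where v: "v1 < \<mu>" "\<mu> < v2" "two_point_mean \<mu> \<phi> v1 v2 = s"
      and r_eq: "r = g_ratio \<mu> \<psi>u \<psi>l v1 v2"
      using r unfolding two_point_ratios_eq by blast
    obtain P where P: "prob_space P" "sets P = sets borel"
      "\<And>f. f \<in> borel_measurable borel \<Longrightarrow> integrable P f \<and> integral\<^sup>L P f = two_point_mean \<mu> f v1 v2"
      using two_point_law[OF v(1,2)] by blast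
    have "P \<in> ratio_class \<mu> s \<phi> \<psi>u \<psi>l"
      using P meas_phi meas_u meas_l v by (simp add: two_point_mean_ident ratio_class_def moment_class_def)
    then show ?thesis
      using P(3) meas_u meas_l by (intro bexI[of _ P]) (simp_all add: r_eq g_ratio_def)
  qed
  show ?thesis
  proof (rule antisym; rule SUP_mono)
    fix P assume "P \<in> ratio_class \<mu> s \<phi> \<psi>u \<psi>l"
    from upper[OF this]
    show "\<exists>r \<in> two_point_ratios \<mu> s \<phi> \<psi>u \<psi>l. ereal (integral\<^sup>L P \<psi>u / integral\<^sup>L P \<psi>l) \<le> ereal r"
      by simp
  next
    fix r assume "r \<in> two_point_ratios \<mu> s \<phi> \<psi>u \<psi>l"
    from lower[OF this]
    show "\<exists>P \<in> ratio_class \<mu> s \<phi> \<psi>u \<psi>l. ereal r \<le> ereal (integral\<^sup>L P \<psi>u / integral\<^sup>L P \<psi>l)"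
      by auto
  qed
qed

end
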